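(* Let $\overline{\varepsilon},\hbar>0$, $n\ge0$, and let $\vec s\in\mathbb{R}^{2n+1}$ satisfy $s_n^{\uparrow}<s_n^{\downarrow}<\cdots<s_1^{\uparrow}<s_1^{\downarrow}<s_0^{\uparrow}$. Put $a=\sum_{i=0}^n s_i^{\uparrow}-\sum_{i=1}^n s_i^{\downarrow}$, and let $f(c|\vec s)$ be the Dobrokhotov--Krichever profile of $\vec s$. (Part I) The original (approximate) spatial periodicity and regular Bohr--Sommerfeld conditions $$|s_i^{\downarrow}-s_{i-1}^{\uparrow}|=\overline{\varepsilon}N_i,\qquad |s_i^{\uparrow}-s_i^{\downarrow}|=\frac{\hbar}{\overline{\varepsilon}}N_i'\qquad (N_i,N_i'\in\mathbb{Z}_+,\ i=1,\dots,n)$$ hold for some $N_i,N_i'$ if and only if $f(c|\vec s)$ is an anisotropic partition profile of anisotropy $(-\hbar/\overline{\varepsilon},\overline{\varepsilon})$ centered at $a$. (Part II) Let $\varepsilon_1=\tfrac12\bigl(\overline{\varepsilon}+\sqrt{\overline{\varepsilon}^2+4\hbar}\bigr)$ and $\varepsilon_2=\tfrac12\bigl(\overline{\varepsilon}-\sqrt{\overline{\varepsilon}^2+4\hbar}\bigr)$. The renormalized (exact) conditions $$|s_i^{\downarrow}-s_{i-1}^{\uparrow}|=\varepsilon_1N_i,\qquad |s_i^{\uparrow}-s_i^{\downarrow}|=\frac{\hbar}{\varepsilon_1}N_i'\qquad (N_i,N_i'\in\mathbb{Z}_+,\ i=1,\dots,n)$$ hold for some $N_i,N_i'$ if and only if $f(c|\vec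 s)$ is an anisotropic partition profile of anisotropy $(\varepsilon_2,\varepsilon_1)$ centered at $a$.
   Context: The Dobrokhotov--Krichever profile $f(c|\vec s)$ is the piecewise-linear (continuous) function of $c\in\mathbb{R}$ with slopes $\pm1$, with local minima exactly at $s_0^{\uparrow},\dots,s_n^{\uparrow}$ and local maxima exactly at $s_1^{\downarrow},\dots,s_n^{\downarrow}$, and with $f(c|\vec s)=|c-a|$ for all sufficiently large $|c|$, where $a=\sum_{i=0}^n s_i^{\uparrow}-\sum_{i=1}^n s_i^{\downarrow}$. For $r_2<0<r_1$ let $R(r_2,r_1)\subset\mathbb{R}^2$ (coordinates $(c,y)$) be the rectangle with a side of length $-r_2\sqrt2$ in the direction of slope $+1$ and a side of length $r_1\sqrt2$ in the direction of slope $-1$. For $a\in\mathbb{R}$, a (continuous) piecewise-linear function $f$ with $f(c)\ge|c-a|$ is an anisotropic partition profile of anisotropy $(r_2,r_1)$ centered at $a$ if the region $\{(c,y)\in\mathbb{R}^2:\ |c-a|<y<f(c)\}$ is, up to boundaries, a disjoint union of finitely many (possibly zero) translates of $R(r_2,r_1)$. *)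

theory Defs
  imports "HOL-Analysis.Analysis"
begin

definition piecewise_linear_with_slopes :: "real set \<Rightarrow> (real \<Rightarrow> real) \<Rightarrow> bool" where
  "piecewise_linear_with_slopes M f \<longleftrightarrow>
     continuous_on UNIV f \<and>
     (\<exists>B. finite B \<and>
        (\<forall>I. is_interval I \<and> I \<inter> B = {} \<longrightarrow> (\<exists>m\<in>M. \<exists>k. \<forall>x\<in>I. f x = m * x + k)))"

definition is_local_min :: "(real \<Rightarrow> real) \<Rightarrow> real \<Rightarrow> bool" where
  "is_local_min f x \<longleftrightarrow> (\<forall>\<^sub>F y in nhds x. f x \<le> f y)"

definition is_local_max :: "(real \<Rightarrow> real) \<Rightarrow> real \<Rightarrow> bool" where
  "is_local_max f x \<longleftrightarrow> (\<forall>\<^sub>F y in nhds x. f y \<le> f x)"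

text \<open>
  The vector \<open>s\<close> of length \<open>2 n + 1\<close> is given by the values \<open>up 0, ..., up n\<close> and
  \<open>down 1, ..., down n\<close>; all other values of \<open>up\<close> and \<open>down\<close> are irrelevant.
\<close>

definition dk_center :: "nat \<Rightarrow> (nat \<Rightarrow> real) \<Rightarrow> (nat \<Rightarrow> real) \<Rightarrow> real" where
  "dk_center n up down = (\<Sum>i=0..n. up i) - (\<Sum>i=1..n. down i)"

text \<open>
  For interlacing \<open>s\<close> exactly one function satisfies this predicate, namely
  \<open>f c = (\<Sum>i=0..n. \<bar>c - up i\<bar>) - (\<Sum>i=1..n. \<bar>c - down i\<bar>)\<close>.
\<close>

definition is_dk_profile ::
  "nat \<Rightarrow> (nat \<Rightarrow> real) \<Rightarrow> (nat \<Rightarrow> real) \<Rightarrow> (real \<Rightarrow> real) \<Rightarrow> bool" where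
  "is_dk_profile n up down f \<longleftrightarrow>
     piecewise_linear_with_slopes {-1, 1} f \<and>
     {c. is_local_min f c} = up ` {0..n} \<and>
     {c. is_local_max f c} = down ` {1..n} \<and>
     (\<forall>\<^sub>F c in at_infinity. f c = \<bar>c - dk_center n up down\<bar>)"

text \<open>
  The closed rectangle spanned by the edge vectors \<open>-r2 * (1, 1)\<close>, of length
  \<open>-r2 * sqrt 2\<close>, and \<open>r1 * (1, -1)\<close>, of length \<open>r1 * sqrt 2\<close>. Only its translates matter,
  so its position is immaterial.
\<close>

definition aniso_rectangle :: "real \<Rightarrow> real \<Rightarrow> (real \<times> real) set" where
  "aniso_rectangle r2 r1 =
     {s *\<^sub>R (1, 1) + t *\<^sub>R (1, -1) | s t. 0 \<le> s \<and> s \<le> - r2 \<and> 0 \<le> t \<and> t \<le> r1}"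

text \<open>
  \<open>D\<close> is a disjoint union of finitely many translates of the closed set \<open>R\<close> up to boundaries:
  the tiles have pairwise disjoint interiors, and \<open>D\<close> differs from their union only in boundary
  points of tiles. No tiles at all (\<open>V = {}\<close>) means \<open>D = {}\<close>.
\<close>

definition tiled_by_translates :: "(real \<times> real) set \<Rightarrow> (real \<times> real) set \<Rightarrow> bool" where
  "tiled_by_translates R D \<longleftrightarrow>
     (\<exists>V. finite V \<and>
        disjoint_family_on (\<lambda>v. interior ((+) v ` R)) V \<and>
        (\<Union>v\<in>V. interior ((+) v ` R)) \<subseteq> D \<and>
        D \<subseteq> (\<Union>v\<in>V. (+) v ` R))"

definition is_aniso_partition_profile ::
  "real \<Rightarrow> real \<Rightarrow> real \<Rightarrow> (real \<Rightarrow> real) \<Rightarrow> bool" where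
  "is_aniso_partition_profile r2 r1 a f \<longleftrightarrow>
     r2 < 0 \<and> 0 < r1 \<and>
     piecewise_linear_with_slopes UNIV f \<and>
     (\<forall>c. \<bar>c - a\<bar> \<le> f c) \<and>
     tiled_by_translates (aniso_rectangle r2 r1) {(c, y). \<bar>c - a\<bar> < y \<and> y < f c}"

end

theory Submission
  imports Defs
begin

text \<open>
  In the coordinates \<open>s = (c + y) / 2\<close>, \<open>t = (c - y) / 2\<close> the rectangles are axis-parallel and the
  graph of \<open>f\<close> is a monotone staircase. The region is the part of the quadrant
  \<open>s > a / 2\<close>, \<open>t < a / 2\<close> below it, and its side lengths are the differences of consecutive
  extrema of \<open>f\<close>.

  If these are multiples of the sides of the rectangle, every point of the graph has \<open>s\<close> or \<open>t\<close>
  on the lattice with origin \<open>(a / 2, a / 2)\<close>, so the graph cuts no open lattice cell, and the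
  cells inside the region tile it. Conversely, a generic line of constant \<open>t\<close> (or \<open>s\<close>) meets the
  region in an interval from the side of the quadrant to the staircase, and a tiling cuts it into
  intervals of equal length; hence every corner of the staircase is a lattice point.

  Both parts are instances of this, since \<open>eps1 * eps2 = - hbar\<close>.
\<close>

section \<open>Piecewise linear functions with slopes \<open>\<plusminus> 1\<close>\<close>

text \<open>There are finitely many breakpoints, so both punctured sides of \<open>x\<close> avoid
  them near \<open>x\<close>. Continuity then extends the affine formula to \<open>x\<close>, which
  may itself be a breakpoint.\<close>

lemma piecewise_linear_one_sided:
  assumes "piecewise_linear_with_slopes M f"
  obtains d m1 m2 where "d > 0" "m1 \<in> M" "m2 \<in> M"
    "\<forall>y\<in>{x - d..x}. f y = f x + m1 * (y - x)"
    "\<forall>y\<in>{x..x + d}. f y = f x + m2 * (y - x)"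
proof -
  from assms obtain B where cont: "continuous_on UNIV f" and "finite B"
    and B: "\<And>I. is_interval I \<Longrightarrow> I \<inter> B = {} \<Longrightarrow> \<exists>m\<in>M. \<exists>k. \<forall>x\<in>I. f x = m * x + k"
    unfolding piecewise_linear_with_slopes_def by blast
  obtain d where d: "d > 0" "\<forall>b\<in>B. b \<noteq> x \<longrightarrow> d \<le> dist x b"
    using finite_set_avoid[OF \<open>finite B\<close>] by blast
  have affine: "\<exists>m\<in>M. \<forall>y\<in>{l..r}. f y = f x + m * (y - x)"
    if "l < r" and lr: "{l<..<r} \<inter> B = {}" and "x \<in> {l..r}" for l r
  proof -
    obtain m k where m: "m \<in> M" "\<forall>y\<in>{l<..<r}. f y = m * y + k"
      using B[OF is_interval_oo lr] by blast
    have const: "f y - m * y = k" if "y \<in> {l..r}" for y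
    proof (rule continuous_constant_on_closure[of "{l<..<r}" "\<lambda>y. f y - m * y"])
      show "continuous_on (closure {l<..<r}) (\<lambda>y. f y - m * y)"
        by (intro continuous_intros continuous_on_subset[OF cont subset_UNIV])
    qed (use m(2) that \<open>l < r\<close> in auto)
    have "f y = f x + m * (y - x)" if "y \<in> {l..r}" for y
      using const[OF that] const[OF \<open>x \<in> {l..r}\<close>] by (simp add: algebra_simps)
    with \<open>m \<in> M\<close> show ?thesis by blast
  qed
  have avoid: "{x - d<..<x} \<inter> B = {}" "{x<..<x + d} \<inter> B = {}"
    using d by (fastforce simp: dist_real_def)+
  have around: "x - d < x" "x \<in> {x - d..x}" "x < x + d" "x \<in> {x..x + d}"
    using d(1) by auto
  obtain m1 where m1: "m1 \<in> M" "\<forall>y\<in>{x - d..x}. f y = f x + m1 * (y - x)"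
    using affine[OF around(1) avoid(1) around(2)] by blast
  obtain m2 where m2: "m2 \<in> M" "\<forall>y\<in>{x..x + d}. f y = f x + m2 * (y - x)"
    using affine[OF around(3) avoid(2) around(4)] by blast
  show thesis
    by (rule that[OF d(1) m1(1) m2(1) m1(2) m2(2)])
qed

lemma piecewise_linear_slopes_mono:
  "piecewise_linear_with_slopes M f \<Longrightarrow> M \<subseteq> M' \<Longrightarrow> piecewise_linear_with_slopes M' f"
  unfolding piecewise_linear_with_slopes_def by (meson subsetD)

text \<open>Off the finite breakpoint set the derivative is 1 or -1, so the increment is the
  integral of a function bounded by 1. This is what makes both rotated coordinates of the graph
  monotone.\<close>

lemma piecewise_linear_lipschitz:
  assumes pl: "piecewise_linear_with_slopes {-1, 1} f" and "x \<le> y"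
  shows "\<bar>f y - f x\<bar> \<le> y - x"
proof -
  from pl obtain B where cont: "continuous_on UNIV f" and "finite B"
    and B: "\<And>I. is_interval I \<Longrightarrow> I \<inter> B = {} \<Longrightarrow> \<exists>m\<in>{-1,1}. \<exists>k. \<forall>x\<in>I. f x = m * x + k"
    unfolding piecewise_linear_with_slopes_def by blast
  have "\<exists>m\<in>{-1,1}. (f has_vector_derivative m) (at z)" if "z \<notin> B" for z
  proof -
    obtain e where e: "e > 0" "\<forall>b\<in>B. b \<noteq> z \<longrightarrow> e \<le> dist z b"
      using finite_set_avoid[OF \<open>finite B\<close>] by blast
    then have "{z - e<..<z + e} \<inter> B = {}"
      using that by (fastforce simp: dist_real_def)
    from B[OF is_interval_oo this] obtain m k
      where m: "m \<in> {-1,1}" "\<forall>x\<in>{z - e<..<z + e}. f x = m * x + k"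
      by blast
    have "((\<lambda>x. m * x + k) has_real_derivative m) (at z)"
      by (auto intro!: derivative_eq_intros)
    then have "(f has_real_derivative m) (at z)"
      by (rule has_field_derivative_transform_within_open[of _ _ _ "{z - e<..<z + e}"])
         (use m e in auto)
    with m show ?thesis
      by (auto simp: has_real_derivative_iff_has_vector_derivative)
  qed
  then obtain f' where f': "\<And>z. z \<notin> B \<Longrightarrow> f' z \<in> {-1,1} \<and> (f has_vector_derivative f' z) (at z)"
    by metis
  \<comment> \<open>Nothing is known of \<open>f'\<close> on \<open>B\<close>; the value 0 there
    makes the bound by 1 hold everywhere.\<close>
  define g where "g z = (if z \<in> B then 0 else f' z)" for z
  have "(g has_integral (f y - f x)) {x..y}"
    by (rule fundamental_theorem_of_calculus_interior_strong[OF \<open>finite B\<close> \<open>x \<le> y\<close>])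
       (use f' in \<open>auto simp: g_def intro: continuous_on_subset[OF cont]\<close>)
  moreover have "norm (g z) \<le> 1" for z
    using f'[of z] by (auto simp: g_def)
  ultimately show ?thesis
    using has_integral_bound[of 1 g "f y - f x" x y] \<open>x \<le> y\<close> by auto
qed

text \<open>With slopes 1 and -1 only, every change of slope is a local extremum. Hence
  \<open>f\<close> is locally affine on the open interval, which the disjoint open sets
  \<open>U (-1)\<close> and \<open>U 1\<close> cover. By connectedness a single slope occurs, and
  continuity adds the end points.\<close>

lemma piecewise_linear_affine_between_extrema:
  assumes pl: "piecewise_linear_with_slopes {-1, 1} f" and "l < r"
    and noex: "\<And>x. l < x \<Longrightarrow> x < r \<Longrightarrow> \<not> is_local_min f x \<and> \<not> is_local_max f x"
  obtains m where "m \<in> {-1, 1}" "\<And>x. l \<le> x \<Longrightarrow> x \<le> r \<Longrightarrow> f x = f l + m * (x - l)"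
proof -
  define U where "U m = {x. \<exists>d>0. \<forall>y. \<bar>y - x\<bar> < d \<longrightarrow> f y = f x + m * (y - x)}" for m :: real
  have near: "eventually P (nhds x)" if "d > 0" "\<And>y. \<bar>y - x\<bar> < d \<Longrightarrow> P y" for P d and x :: real
    using that by (auto simp: eventually_nhds_metric dist_real_def)
  have cover: "x \<in> U (-1) \<union> U 1" if "l < x" "x < r" for x
  proof -
    obtain d m1 m2 where d: "d > 0" "m1 \<in> {-1,1}" "m2 \<in> {-1,1}"
      "\<forall>y\<in>{x - d..x}. f y = f x + m1 * (y - x)"
      "\<forall>y\<in>{x..x + d}. f y = f x + m2 * (y - x)"
      by (rule piecewise_linear_one_sided[OF pl])
    have loc: "f y - f x = (if y \<le> x then m1 else m2) * (y - x)" if "\<bar>y - x\<bar> < d" for y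
      using d(4)[rule_format, of y] d(5)[rule_format, of y] that by auto
    have "m1 = m2"
    proof (rule ccontr)
      assume "m1 \<noteq> m2"
      with d(2,3) consider "m1 = -1" "m2 = 1" | "m1 = 1" "m2 = -1" by auto
      then show False
      proof cases
        case 1
        have "is_local_min f x" unfolding is_local_min_def
        proof (rule near[OF d(1)])
          fix y assume "\<bar>y - x\<bar> < d"
          from loc[OF this] 1 show "f x \<le> f y" by (auto split: if_splits)
        qed
        with noex that show False by blast
      next
        case 2
        have "is_local_max f x" unfolding is_local_max_def
        proof (rule near[OF d(1)])
          fix y assume "\<bar>y - x\<bar> < d"
          from loc[OF this] 2 show "f y \<le> f x" by (auto split: if_splits)
        qed
        with noex that show False by blast
      qed
    qed
    then have "f y = f x + m1 * (y - x)" if "\<bar>y - x\<bar> < d" for y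
      using loc[OF that] by (simp split: if_splits)
    then have "x \<in> U m1"
      unfolding U_def using d(1) by blast
    with d(2) show ?thesis by auto
  qed
  have openU: "open (U m)" for m
    unfolding open_dist
  proof (rule ballI)
    fix x assume "x \<in> U m"
    then obtain d where d: "d > 0" "\<forall>y. \<bar>y - x\<bar> < d \<longrightarrow> f y = f x + m * (y - x)"
      unfolding U_def by blast
    have "z \<in> U m" if z: "\<bar>z - x\<bar> < d" for z
    proof -
      have "f y = f z + m * (y - z)" if "\<bar>y - z\<bar> < d - \<bar>z - x\<bar>" for y
      proof -
        have "\<bar>y - x\<bar> < d" using that by linarith
        then show ?thesis
          using d(2)[rule_format, of y] d(2)[rule_format, of z] z
          by (simp add: algebra_simps)
      qed
      moreover have "d - \<bar>z - x\<bar> > 0" using z by simp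
      ultimately show ?thesis unfolding U_def by blast
    qed
    with d(1) show "\<exists>e>0. \<forall>y. dist y x < e \<longrightarrow> y \<in> U m"
      unfolding dist_real_def by blast
  qed
  have disj: "U (-1) \<inter> U 1 = {}"
  proof (rule ccontr)
    assume "U (-1) \<inter> U 1 \<noteq> {}"
    then obtain x d1 d2 where d: "d1 > 0" "\<forall>y. \<bar>y - x\<bar> < d1 \<longrightarrow> f y = f x + (-1) * (y - x)"
      "d2 > 0" "\<forall>y. \<bar>y - x\<bar> < d2 \<longrightarrow> f y = f x + 1 * (y - x)"
      unfolding U_def by blast
    define y where "y = x + min d1 d2 / 2"
    have "\<bar>y - x\<bar> < d1" "\<bar>y - x\<bar> < d2" "y \<noteq> x"
      using d(1,3) by (auto simp: y_def)
    then show False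
      using d(2)[rule_format, of y] d(4)[rule_format, of y] by simp
  qed
  have "{l<..<r} \<subseteq> U (-1) \<union> U 1"
    using cover by (metis greaterThanLessThan_iff subsetI)
  with disj have "U (-1) \<inter> {l<..<r} = {} \<or> U 1 \<inter> {l<..<r} = {}"
    by (intro connectedD[OF _ openU openU]) auto
  then obtain m where m: "m \<in> {-1, 1}" "\<And>x. l < x \<Longrightarrow> x < r \<Longrightarrow> x \<in> U m"
    using cover by (metis IntI UnE empty_iff greaterThanLessThan_iff insertCI)
  have "continuous_on UNIV f" using pl by (simp add: piecewise_linear_with_slopes_def)
  moreover have "((\<lambda>y. f y - m * y) has_real_derivative 0) (at x)" if x: "l < x" "x < r" for x
  proof -
    obtain d where d: "d > 0" "\<forall>y. \<bar>y - x\<bar> < d \<longrightarrow> f y = f x + m * (y - x)"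
      using m(2)[OF x] by (auto simp: U_def)
    have eq: "f x - m * x = f y - m * y" if "dist y x < d" for y
      using d(2)[rule_format, of y] that by (simp add: dist_real_def algebra_simps)
    show ?thesis
      by (rule has_field_derivative_transform_within[of "\<lambda>y. f x - m * x" _ _ _ d])
         (use d(1) eq in auto)
  qed
  ultimately have "f x - m * x = f l - m * l" if "l \<le> x" "x \<le> r" for x
    using that \<open>l < r\<close>
    by (intro DERIV_isconst2[of l r "\<lambda>y. f y - m * y"])
       (auto intro!: continuous_intros intro: continuous_on_subset)
  then have "f x = f l + m * (x - l)" if "l \<le> x" "x \<le> r" for x
    using that by (simp add: algebra_simps)
  with m(1) show thesis by (rule that)
qed

text \<open>Serves to exclude slope -1 on the piece to the right of a minimum.\<close>

lemma local_min_slope_nonneg: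
  assumes "is_local_min f l" "l < r" and aff: "\<And>x. l \<le> x \<Longrightarrow> x \<le> r \<Longrightarrow> f x = f l + m * (x - l)"
  shows "m \<ge> 0"
proof -
  obtain d where d: "d > 0" "\<And>y. \<bar>y - l\<bar> < d \<Longrightarrow> f l \<le> f y"
    using assms(1) by (auto simp: is_local_min_def eventually_nhds_metric dist_real_def)
  define h where "h = min d (r - l) / 2"
  have h: "0 < h" "h < d" "l + h \<le> r"
    using d(1) \<open>l < r\<close> by (auto simp: h_def min_def field_simps)
  with d(2)[of "l + h"] aff[of "l + h"] have "m * h \<ge> 0" by auto
  with h(1) show ?thesis by (simp add: zero_le_mult_iff)
qed

lemma local_max_slope_nonpos:
  assumes "is_local_max f l" "l < r" and aff: "\<And>x. l \<le> x \<Longrightarrow> x \<le> r \<Longrightarrow> f x = f l + m * (x - l)"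
  shows "m \<le> 0"
proof -
  have "is_local_min (\<lambda>x. - f x) l" using assms(1) by (simp add: is_local_min_def is_local_max_def)
  moreover have "- f x = - f l + (- m) * (x - l)" if "l \<le> x" "x \<le> r" for x
    using aff[OF that] by (simp add: algebra_simps)
  ultimately have "- m \<ge> 0" by (rule local_min_slope_nonneg[OF _ \<open>l < r\<close>])
  then show ?thesis by simp
qed

section \<open>Tilings by parallel rectangles\<close>

text \<open>Half sum and half difference are the coordinates s and t, in which a tile is a box with
  least corner \<open>v\<close>. The argument is written \<open>- q\<close> because the first
  anisotropy is negative; \<open>q\<close> is then the side along s.\<close>

lemma translate_aniso_rectangle:
  "(+) v ` aniso_rectangle (- q) p =
     {(c, y). (fst v + snd v) / 2 \<le> (c + y) / 2 \<and> (c + y) / 2 \<le> (fst v + snd v) / 2 + q \<and>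
              (fst v - snd v) / 2 \<le> (c - y) / 2 \<and> (c - y) / 2 \<le> (fst v - snd v) / 2 + p}"
    (is "?L = ?R")
proof (intro set_eqI iffI)
  fix z assume "z \<in> ?L"
  then show "z \<in> ?R" by (cases v) (auto simp: aniso_rectangle_def field_simps)
next
  fix z assume z: "z \<in> ?R"
  obtain c y where cy: "z = (c, y)" by fastforce
  define s t where "s = (c + y) / 2 - (fst v + snd v) / 2" and "t = (c - y) / 2 - (fst v - snd v) / 2"
  have "z = v + (s *\<^sub>R (1, 1) + t *\<^sub>R (1, -1))"
    by (cases v) (auto simp: cy s_def t_def field_simps)
  moreover have "0 \<le> s" "s \<le> - (- q)" "0 \<le> t" "t \<le> p"
    using z unfolding cy s_def t_def mem_Collect_eq prod.case by linarith+
  ultimately show "z \<in> ?L" unfolding aniso_rectangle_def by blast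
qed

text \<open>An injective linear map of the plane commutes with taking interiors, so the interior can
  be computed for the box in s and t.\<close>

lemma interior_translate_aniso_rectangle:
  "interior ((+) v ` aniso_rectangle (- q) p) =
     {(c, y). (fst v + snd v) / 2 < (c + y) / 2 \<and> (c + y) / 2 < (fst v + snd v) / 2 + q \<and>
              (fst v - snd v) / 2 < (c - y) / 2 \<and> (c - y) / 2 < (fst v - snd v) / 2 + p}"
    (is "_ = ?R")
proof -
  define L :: "real \<times> real \<Rightarrow> real \<times> real" where "L = (\<lambda>(s, t). (s + t, s - t))"
  have L: "linear L" "inj L"
    by (auto simp: L_def linear_iff algebra_simps inj_on_def)
  have "aniso_rectangle (- q) p = L ` ({0..q} \<times> {0..p})"
    by (force simp: aniso_rectangle_def L_def image_iff)
  then have "interior ((+) v ` aniso_rectangle (- q) p) = (+) v ` L ` ({0<..<q} \<times> {0<..<p})"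
    using L by (simp add: interior_translation interior_injective_linear_image interior_Times)
  also have "\<dots> = ?R"
  proof (intro set_eqI iffI)
    fix z assume "z \<in> (+) v ` L ` ({0<..<q} \<times> {0<..<p})"
    then show "z \<in> ?R" by (cases v) (auto simp: L_def field_simps)
  next
    fix z assume z: "z \<in> ?R"
    obtain c y where cy: "z = (c, y)" by fastforce
    define s t where "s = (c + y) / 2 - (fst v + snd v) / 2" and "t = (c - y) / 2 - (fst v - snd v) / 2"
    have "z = v + L (s, t)"
      by (cases v) (auto simp: cy s_def t_def L_def field_simps)
    moreover have "0 < s" "s < q" "0 < t" "t < p"
      using z unfolding cy s_def t_def mem_Collect_eq prod.case by linarith+
    then have "(s, t) \<in> {0<..<q} \<times> {0<..<p}" by simp
    ultimately show "z \<in> (+) v ` L ` ({0<..<q} \<times> {0<..<p})" by blast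
  qed
  finally show ?thesis .
qed

lemma mem_translate_aniso_rectangle:
  "(s + t, s - t) \<in> (+) v ` aniso_rectangle (- q) p \<longleftrightarrow>
     (fst v + snd v) / 2 \<le> s \<and> s \<le> (fst v + snd v) / 2 + q \<and>
     (fst v - snd v) / 2 \<le> t \<and> t \<le> (fst v - snd v) / 2 + p"
proof -
  have "(s + t + (s - t)) / 2 = s" "(s + t - (s - t)) / 2 = t" by simp_all
  then show ?thesis unfolding translate_aniso_rectangle mem_Collect_eq prod.case by (simp only:)
qed

lemma mem_interior_translate_aniso_rectangle:
  "(s + t, s - t) \<in> interior ((+) v ` aniso_rectangle (- q) p) \<longleftrightarrow>
     (fst v + snd v) / 2 < s \<and> s < (fst v + snd v) / 2 + q \<and>
     (fst v - snd v) / 2 < t \<and> t < (fst v - snd v) / 2 + p"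
proof -
  have "(s + t + (s - t)) / 2 = s" "(s + t - (s - t)) / 2 = t" by simp_all
  then show ?thesis unfolding interior_translate_aniso_rectangle mem_Collect_eq prod.case by (simp only:)
qed

text \<open>Compare Lebesgue measures: the cover by closed intervals bounds \<open>r - l\<close>
  from above, the packing by open ones from below, and both kinds have length
  \<open>q\<close>.\<close>

lemma interval_length_if_tiled:
  fixes u :: "'v \<Rightarrow> real"
  assumes "finite V" "q \<ge> 0" "l \<le> r"
    and disj: "disjoint_family_on (\<lambda>v. {u v<..<u v + q}) V"
    and sub: "(\<Union>v\<in>V. {u v<..<u v + q}) \<subseteq> {l<..<r}"
    and sup: "{l<..<r} \<subseteq> (\<Union>v\<in>V. {u v..u v + q})"
  shows "r - l = q * real (card V)"
proof (rule antisym)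
  have "r - l = measure lborel {l<..<r}" using \<open>l \<le> r\<close> by simp
  also have "\<dots> \<le> measure lborel (\<Union>v\<in>V. {u v..u v + q})"
    using \<open>finite V\<close> sup
    by (intro measure_mono_fmeasurable) (auto intro!: fmeasurable_compact compact_UN)
  also have "\<dots> \<le> (\<Sum>v\<in>V. measure lborel {u v..u v + q})"
    using \<open>finite V\<close> by (intro measure_UNION_le) auto
  finally show "r - l \<le> q * real (card V)"
    using \<open>q \<ge> 0\<close> by (simp add: mult.commute)
  have "q * real (card V) = (\<Sum>v\<in>V. measure lborel {u v<..<u v + q})"
    using \<open>q \<ge> 0\<close> by (simp add: mult.commute)
  also have "\<dots> = measure lborel (\<Union>v\<in>V. {u v<..<u v + q})"
    using \<open>finite V\<close> disj \<open>q \<ge> 0\<close> by (intro measure_finite_Union[symmetric]) auto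
  also have "\<dots> \<le> measure lborel {l<..<r}"
    using sub \<open>finite V\<close> \<open>l \<le> r\<close>
    by (intro measure_mono_fmeasurable) (auto intro!: fmeasurableI)
  finally show "q * real (card V) \<le> r - l" using \<open>l \<le> r\<close> by simp
qed

text \<open>A line of constant t that runs along no edge of a tile meets each tile either not at all
  or in a full interval of length \<open>q\<close>, so the slice of \<open>D\<close> is tiled by
  intervals. A whole strip of lines is assumed so that such a line can be chosen.\<close>

lemma tiled_slice_first:
  assumes "tiled_by_translates (aniso_rectangle (- q) p) D" and "q > 0" "l \<le> r" "t1 < t2"
    and slice: "\<And>s t. t1 < t \<Longrightarrow> t < t2 \<Longrightarrow> (s + t, s - t) \<in> D \<longleftrightarrow> l < s \<and> s < r"
  obtains m :: nat where "r - l = q * real m"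
proof -
  obtain V where "finite V"
    and disj: "disjoint_family_on (\<lambda>v. interior ((+) v ` aniso_rectangle (- q) p)) V"
    and sub: "(\<Union>v\<in>V. interior ((+) v ` aniso_rectangle (- q) p)) \<subseteq> D"
    and sup: "D \<subseteq> (\<Union>v\<in>V. (+) v ` aniso_rectangle (- q) p)"
    using assms(1) unfolding tiled_by_translates_def by blast
  define u where "u v = (fst v + snd v) / 2" for v :: "real \<times> real"
  define w where "w v = (fst v - snd v) / 2" for v :: "real \<times> real"
  \<comment> \<open>These are the finitely many levels of t that contain an edge. Away from them a
    closed tile meets the line exactly if its interior does.\<close>
  have "finite (w ` V \<union> (\<lambda>v. w v + p) ` V)" using \<open>finite V\<close> by simp
  then have "infinite ({t1<..<t2} - (w ` V \<union> (\<lambda>v. w v + p) ` V))"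
    using infinite_Ioo[OF \<open>t1 < t2\<close>] by (rule Diff_infinite_finite)
  then obtain t where "t \<in> {t1<..<t2} - (w ` V \<union> (\<lambda>v. w v + p) ` V)"
    using infinite_imp_nonempty by blast
  then have t: "t1 < t" "t < t2" and generic: "\<And>v. v \<in> V \<Longrightarrow> t \<noteq> w v \<and> t \<noteq> w v + p"
    by auto
  have opened: "(s + t, s - t) \<in> interior ((+) v ` aniso_rectangle (- q) p) \<longleftrightarrow>
      u v < s \<and> s < u v + q \<and> w v < t \<and> t < w v + p" for v s
    by (simp only: mem_interior_translate_aniso_rectangle u_def w_def)
  have closed: "(s + t, s - t) \<in> (+) v ` aniso_rectangle (- q) p \<longleftrightarrow>
      u v \<le> s \<and> s \<le> u v + q \<and> w v \<le> t \<and> t \<le> w v + p" for v s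
    by (simp only: mem_translate_aniso_rectangle u_def w_def)
  define W where "W = {v \<in> V. w v < t \<and> t < w v + p}"
  have "r - l = q * real (card W)"
  proof (rule interval_length_if_tiled)
    show "finite W" using \<open>finite V\<close> by (simp add: W_def)
    show "disjoint_family_on (\<lambda>v. {u v<..<u v + q}) W"
      unfolding disjoint_family_on_def
    proof (intro ballI impI equals0I)
      fix v v' s assume "v \<in> W" "v' \<in> W" "v \<noteq> v'" "s \<in> {u v<..<u v + q} \<inter> {u v'<..<u v' + q}"
      then have "(s + t, s - t) \<in> interior ((+) v ` aniso_rectangle (- q) p) \<inter>
          interior ((+) v' ` aniso_rectangle (- q) p)"
        by (simp add: opened W_def)
      with disj \<open>v \<in> W\<close> \<open>v' \<in> W\<close> \<open>v \<noteq> v'\<close> show False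
        unfolding disjoint_family_on_def W_def by blast
    qed
    show "(\<Union>v\<in>W. {u v<..<u v + q}) \<subseteq> {l<..<r}"
    proof
      fix s assume "s \<in> (\<Union>v\<in>W. {u v<..<u v + q})"
      then have "(s + t, s - t) \<in> (\<Union>v\<in>V. interior ((+) v ` aniso_rectangle (- q) p))"
        by (auto simp: opened W_def)
      with sub slice[OF t] show "s \<in> {l<..<r}" by auto
    qed
    show "{l<..<r} \<subseteq> (\<Union>v\<in>W. {u v..u v + q})"
    proof
      fix s assume "s \<in> {l<..<r}"
      then have "(s + t, s - t) \<in> D" using slice[OF t] by simp
      with sup obtain v where "v \<in> V" "(s + t, s - t) \<in> (+) v ` aniso_rectangle (- q) p"
        by blast
      with generic[OF \<open>v \<in> V\<close>] have "v \<in> W" "s \<in> {u v..u v + q}"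
        unfolding closed W_def by auto
      then show "s \<in> (\<Union>v\<in>W. {u v..u v + q})" by blast
    qed
  qed (use assms in auto)
  then show thesis by (rule that)
qed

lemma tiled_slice_second:
  assumes "tiled_by_translates (aniso_rectangle (- q) p) D" and "p > 0" "l \<le> r" "s1 < s2"
    and slice: "\<And>s t. s1 < s \<Longrightarrow> s < s2 \<Longrightarrow> (s + t, s - t) \<in> D \<longleftrightarrow> l < t \<and> t < r"
  obtains m :: nat where "r - l = p * real m"
proof -
  txt \<open>The reflection \<open>y \<mapsto> - y\<close> exchanges the coordinates \<open>s\<close> and \<open>t\<close>.\<close>
  define refl :: "real \<times> real \<Rightarrow> real \<times> real" where "refl v = (fst v, - snd v)" for v
  have refl_tile: "(+) (refl v) ` aniso_rectangle (- p) q = refl -` (+) v ` aniso_rectangle (- q) p" for v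
    by (auto simp: translate_aniso_rectangle refl_def)
  have refl_interior: "interior ((+) (refl v) ` aniso_rectangle (- p) q) =
      refl -` interior ((+) v ` aniso_rectangle (- q) p)" for v
    by (auto simp: interior_translate_aniso_rectangle refl_def)
  obtain V where V: "finite V"
    "disjoint_family_on (\<lambda>v. interior ((+) v ` aniso_rectangle (- q) p)) V"
    "(\<Union>v\<in>V. interior ((+) v ` aniso_rectangle (- q) p)) \<subseteq> D"
    "D \<subseteq> (\<Union>v\<in>V. (+) v ` aniso_rectangle (- q) p)"
    using assms(1) unfolding tiled_by_translates_def by blast
  have "tiled_by_translates (aniso_rectangle (- p) q) (refl -` D)"
    unfolding tiled_by_translates_def
  proof (intro exI[of _ "refl ` V"] conjI)
    show "finite (refl ` V)" using V(1) by simp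
    show "disjoint_family_on (\<lambda>v. interior ((+) v ` aniso_rectangle (- p) q)) (refl ` V)"
      unfolding disjoint_family_on_def
    proof (intro ballI impI)
      fix x x' assume "x \<in> refl ` V" "x' \<in> refl ` V" "x \<noteq> x'"
      then obtain v v' where v: "v \<in> V" "v' \<in> V" "v \<noteq> v'" "x = refl v" "x' = refl v'"
        by blast
      have "interior ((+) v ` aniso_rectangle (- q) p) \<inter>
          interior ((+) v' ` aniso_rectangle (- q) p) = {}"
        using V(2) v(1-3) unfolding disjoint_family_on_def by blast
      then show "interior ((+) x ` aniso_rectangle (- p) q) \<inter>
          interior ((+) x' ` aniso_rectangle (- p) q) = {}"
        unfolding v(4,5) refl_interior vimage_Int[symmetric] by simp
    qed
    show "(\<Union>v\<in>refl ` V. interior ((+) v ` aniso_rectangle (- p) q)) \<subseteq> refl -` D"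
      unfolding UN_simps refl_interior using V(3) by blast
    show "refl -` D \<subseteq> (\<Union>v\<in>refl ` V. (+) v ` aniso_rectangle (- p) q)"
      unfolding UN_simps refl_tile using V(4) by blast
  qed
  then show thesis
  proof (rule tiled_slice_first[OF _ \<open>p > 0\<close> \<open>l \<le> r\<close> \<open>s1 < s2\<close>])
    show "(t + s, t - s) \<in> refl -` D \<longleftrightarrow> l < t \<and> t < r" if "s1 < s" "s < s2" for s t
      using slice[OF that, of t] by (simp add: refl_def add.commute)
  qed (rule that)
qed

text \<open>Only the second point is strictly inside: any positive weight on it pulls the
  combination off the boundary. This serves segments that start on the edge of a cell.\<close>

lemma convex_combination_gt:
  fixes x y u l :: real
  assumes "l \<le> x" "l < y" "0 < u" "u \<le> 1"
  shows "l < (1 - u) * x + u * y"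
proof -
  have "(1 - u) * (x - l) \<ge> 0" "u * (y - l) > 0" using assms by simp_all
  then show ?thesis by (simp add: algebra_simps)
qed

lemma convex_combination_lt:
  fixes x y u r :: real
  assumes "x \<le> r" "y < r" "0 < u" "u \<le> 1"
  shows "(1 - u) * x + u * y < r"
  using convex_combination_gt[of "- r" "- x" "- y" u] assms by simp

section \<open>The staircase of a Dobrokhotov--Krichever profile\<close>

text \<open>Larger indices lie further left: \<open>up n\<close> is the leftmost extremum and
  \<open>up 0\<close> the rightmost.\<close>

locale dk_profile =
  fixes n :: nat and up down :: "nat \<Rightarrow> real" and f :: "real \<Rightarrow> real"
  assumes interlace: "i \<in> {1..n} \<Longrightarrow> up i < down i \<and> down i < up (i - 1)"
    and profile: "is_dk_profile n up down f"
begin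

abbreviation center :: real where
  "center \<equiv> dk_center n up down"

text \<open>\<open>S c\<close> and \<open>T c\<close> are the coordinates s and t of the graph point
  over \<open>c\<close>. As the slopes are 1 and -1, only one of them changes at a time, which gives
  the staircase.\<close>

definition S :: "real \<Rightarrow> real" where "S c = (c + f c) / 2"
definition T :: "real \<Rightarrow> real" where "T c = (c - f c) / 2"

definition region :: "(real \<times> real) set" where
  "region = {(c, y). \<bar>c - center\<bar> < y \<and> y < f c}"

lemma S_plus_T: "S c + T c = c"
  by (simp add: S_def T_def field_simps)

lemma pl: "piecewise_linear_with_slopes {-1, 1} f"
  using profile by (simp add: is_dk_profile_def)

lemma is_local_min_iff: "is_local_min f x \<longleftrightarrow> x \<in> up ` {0..n}"
  using profile by (auto simp: is_dk_profile_def)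

lemma is_local_max_iff: "is_local_max f x \<longleftrightarrow> x \<in> down ` {1..n}"
  using profile by (auto simp: is_dk_profile_def)

lemma S_mono: "x \<le> y \<Longrightarrow> S x \<le> S y"
  using piecewise_linear_lipschitz[OF pl] by (fastforce simp: S_def abs_le_iff)

lemma T_mono: "x \<le> y \<Longrightarrow> T x \<le> T y"
  using piecewise_linear_lipschitz[OF pl] by (fastforce simp: T_def abs_le_iff)

section \<open>Edges and ends of the staircase\<close>

lemma up_antimono: "i \<le> j \<Longrightarrow> j \<le> n \<Longrightarrow> up j \<le> up i"
proof (induction j rule: dec_induct)
  case (step j)
  with interlace[of "Suc j"] show ?case by simp
qed simp

text \<open>Together with \<open>down_outside\<close>: the only extremum strictly between
  \<open>up i\<close> and \<open>up (i - 1)\<close> is \<open>down i\<close>, so \<open>f\<close> is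
  affine on either side of it.\<close>

lemma up_outside:
  assumes "i \<in> {1..n}" "j \<le> n"
  shows "up j \<le> up i \<or> up (i - 1) \<le> up j"
  using assms up_antimono[of i j] up_antimono[of j "i - 1"] by (cases "i \<le> j") auto

lemma down_outside:
  assumes "i \<in> {1..n}" "j \<in> {1..n}" "j \<noteq> i"
  shows "down j < up i \<or> up (i - 1) < down j"
proof (cases "j < i")
  case True
  then show ?thesis
    using assms up_antimono[of j "i - 1"] interlace[of j] by fastforce
next
  case False
  then show ?thesis
    using assms up_antimono[of i "j - 1"] interlace[of j] by fastforce
qed

text \<open>No extremum lies inside this interval, and the minimum at its left end forces slope 1.
  \<open>S_const\<close> is the mirror image, with a maximum and slope -1.\<close>

lemma T_const:
  assumes i: "i \<in> {1..n}" and c: "up i \<le> c" "c \<le> down i"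
  shows "T c = T (up i)"
proof -
  have "\<not> is_local_min f x \<and> \<not> is_local_max f x" if "up i < x" "x < down i" for x
    using that interlace[OF i] up_outside[OF i] down_outside[OF i]
    unfolding is_local_min_iff is_local_max_iff by fastforce
  then obtain m where m: "m \<in> {-1, 1}"
    "\<And>x. up i \<le> x \<Longrightarrow> x \<le> down i \<Longrightarrow> f x = f (up i) + m * (x - up i)"
    using piecewise_linear_affine_between_extrema[OF pl, of "up i" "down i"] interlace[OF i]
    by metis
  moreover have "is_local_min f (up i)" using i by (simp add: is_local_min_iff)
  ultimately have "m = 1"
    using local_min_slope_nonneg[of f "up i" "down i" m] interlace[OF i] by fastforce
  with m(2)[OF c] show ?thesis by (simp add: T_def)
qed

lemma S_const:
  assumes i: "i \<in> {1..n}" and c: "down i \<le> c" "c \<le> up (i - 1)"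
  shows "S c = S (down i)"
proof -
  have "\<not> is_local_min f x \<and> \<not> is_local_max f x" if "down i < x" "x < up (i - 1)" for x
    using that interlace[OF i] up_outside[OF i] down_outside[OF i]
    unfolding is_local_min_iff is_local_max_iff by fastforce
  then obtain m where m: "m \<in> {-1, 1}"
    "\<And>x. down i \<le> x \<Longrightarrow> x \<le> up (i - 1) \<Longrightarrow> f x = f (down i) + m * (x - down i)"
    using piecewise_linear_affine_between_extrema[OF pl, of "down i" "up (i - 1)"] interlace[OF i]
    by metis
  moreover have "is_local_max f (down i)" using i by (simp add: is_local_max_iff)
  ultimately have "m = -1"
    using local_max_slope_nonpos[of f "down i" "up (i - 1)" m] interlace[OF i] by fastforce
  with m(2)[OF c] show ?thesis by (simp add: S_def)
qed

lemma up_le_extremum: "is_local_min f x \<or> is_local_max f x \<Longrightarrow> up n \<le> x"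
  using up_antimono interlace unfolding is_local_min_iff is_local_max_iff by fastforce

lemma extremum_le_up: "is_local_min f x \<or> is_local_max f x \<Longrightarrow> x \<le> up 0"
proof -
  have "down j \<le> up 0" if "j \<in> {1..n}" for j
    using interlace[OF that] up_antimono[of 0 "j - 1"] that by fastforce
  then show "is_local_min f x \<or> is_local_max f x \<Longrightarrow> x \<le> up 0"
    using up_antimono[of 0] unfolding is_local_min_iff is_local_max_iff by auto
qed

lemma far_away:
  obtains b where "\<And>c. b \<le> \<bar>c\<bar> \<Longrightarrow> f c = \<bar>c - center\<bar>"
  using profile by (auto simp: is_dk_profile_def eventually_at_infinity)

text \<open>There is no extremum left of \<open>up n\<close>, so \<open>f\<close> is affine there
  and must continue the branch \<open>center - c\<close> that it follows far out.\<close>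

lemma S_left: "c \<le> up n \<Longrightarrow> S c = center / 2"
proof -
  assume c: "c \<le> up n"
  obtain b where b: "\<And>c. b \<le> \<bar>c\<bar> \<Longrightarrow> f c = \<bar>c - center\<bar>" using far_away by blast
  \<comment> \<open>Both \<open>l - 1\<close> and \<open>l\<close> lie in the far range and left of
    \<open>center\<close>; two such points determine the affine function, and \<open>c\<close> lies
    to their right.\<close>
  define l where "l = min (- \<bar>b\<bar>) (min c center) - 1"
  have l: "l - 1 < c" "l < center" "b \<le> \<bar>l\<bar>" "b \<le> \<bar>l - 1\<bar>" "l < c" by (auto simp: l_def)
  obtain m where "\<And>x. l - 1 \<le> x \<Longrightarrow> x \<le> up n \<Longrightarrow> f x = f (l - 1) + m * (x - (l - 1))"
    using piecewise_linear_affine_between_extrema[OF pl, of "l - 1" "up n"] up_le_extremum l c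
    by (metis less_le_trans not_le)
  from this[of l] this[of c] have "f l = f (l - 1) + m" "f c = f (l - 1) + m * (c - (l - 1))"
    using l c by auto
  moreover from this(1) b[OF l(3)] b[OF l(4)] l(2) have "m = -1" by simp
  ultimately have "f c = center - c" using b[OF l(4)] l(2) by simp
  then show ?thesis by (simp add: S_def)
qed

lemma T_right: "up 0 \<le> c \<Longrightarrow> T c = center / 2"
proof -
  assume c: "up 0 \<le> c"
  obtain b where b: "\<And>c. b \<le> \<bar>c\<bar> \<Longrightarrow> f c = \<bar>c - center\<bar>" using far_away by blast
  define r where "r = max \<bar>b\<bar> (max c center) + 1"
  have r: "c < r + 1" "center < r" "b \<le> \<bar>r\<bar>" "b \<le> \<bar>r + 1\<bar>" "c < r" by (auto simp: r_def)
  obtain m where m: "m \<in> {-1, 1}"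
    "\<And>x. up 0 \<le> x \<Longrightarrow> x \<le> r + 1 \<Longrightarrow> f x = f (up 0) + m * (x - up 0)"
    using piecewise_linear_affine_between_extrema[OF pl, of "up 0" "r + 1"] extremum_le_up r c
    by (metis le_less_trans not_le)
  from m(2)[of r] m(2)[of "r + 1"] m(2)[of c]
  have "f r = f (up 0) + m * (r - up 0)" "f (r + 1) = f (up 0) + m * (r + 1 - up 0)"
    "f c = f (up 0) + m * (c - up 0)"
    using r c by auto
  with b[OF r(3)] b[OF r(4)] r m(1) have "f c = c - center" by auto
  then show ?thesis by (simp add: T_def)
qed

lemma S_ge: "center / 2 \<le> S c"
  using S_left[of "min c (up n)"] S_mono[of "min c (up n)" c] by simp

lemma T_le: "T c \<le> center / 2"
  using T_right[of "max c (up 0)"] T_mono[of c "max c (up 0)"] by simp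

text \<open>The bounds on \<open>S\<close> and \<open>T\<close> say that the graph stays in the
  quadrant, one for each branch of the absolute value.\<close>

lemma profile_ge: "\<bar>c - center\<bar> \<le> f c"
  using S_ge[of c] T_le[of c] by (simp add: S_def T_def)

text \<open>Since S + T = c, lying below the graph can be read off from \<open>T\<close> or from
  \<open>S\<close>. This form suits lines of constant t, \<open>region_iff_S\<close> those of
  constant s.\<close>

lemma region_iff_T: "(s + t, s - t) \<in> region \<longleftrightarrow> center / 2 < s \<and> t < center / 2 \<and> T (s + t) < t"
  by (auto simp: region_def T_def)

lemma region_iff_S: "(s + t, s - t) \<in> region \<longleftrightarrow> center / 2 < s \<and> t < center / 2 \<and> s < S (s + t)"
  by (auto simp: region_def S_def)

lemma piece_cases:
  obtains "c \<le> up n" | "up 0 \<le> c"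
  | i where "i \<in> {1..n}" "up i \<le> c" "c \<le> down i"
  | i where "i \<in> {1..n}" "down i \<le> c" "c \<le> up (i - 1)"
proof (cases "c \<le> up n \<or> up 0 \<le> c")
  case False
  \<comment> \<open>As \<open>up\<close> decreases with the index, the least index with
    \<open>up i \<le> c\<close> locates \<open>c\<close>; it is positive because \<open>up 0\<close>
    lies to the right of \<open>c\<close>.\<close>
  then obtain k where "k < n" "\<forall>i\<le>k. \<not> up i \<le> c" "up (k + 1) \<le> c"
    using ex_least_nat_less[of "\<lambda>i. up i \<le> c" n] by auto
  then have "k + 1 \<in> {1..n}" "up (k + 1) \<le> c" "c \<le> up (k + 1 - 1)" by auto
  with that(3,4) show thesis by (meson linear)
qed (use that in auto)

text \<open>\<open>T\<close> is constant on this edge, so the whole increment of c = S + T goes into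
  \<open>S\<close>: edge lengths of the staircase are gaps between extrema.\<close>

lemma S_diff: "i \<in> {1..n} \<Longrightarrow> S (down i) - S (up i) = down i - up i"
  using T_const[of i "down i"] interlace[of i] S_plus_T[of "up i"] S_plus_T[of "down i"] by simp

lemma T_diff: "i \<in> {1..n} \<Longrightarrow> T (up (i - 1)) - T (down i) = up (i - 1) - down i"
  using S_const[of i "up (i - 1)"] interlace[of i] S_plus_T[of "up (i - 1)"] S_plus_T[of "down i"]
  by simp

section \<open>From integral side lengths to a tiling\<close>

text \<open>The tiles are the cells of the lattice with origin at the corner of the quadrant whose
  midpoints lie in the region.\<close>

lemma tiled_if_multiples:
  assumes "p > 0" "q > 0"
    and N: "\<And>i. i \<in> {1..n} \<Longrightarrow> up (i - 1) - down i = p * real (N i)"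
    and N': "\<And>i. i \<in> {1..n} \<Longrightarrow> down i - up i = q * real (N' i)"
  shows "tiled_by_translates (aniso_rectangle (- q) p) region"
proof -
  \<comment> \<open>\<open>S\<close> is known at the left end, hence an induction downwards from
    \<open>n\<close>; \<open>T\<close> is known at the right end, hence one upwards from 0.\<close>
  have S_up: "\<exists>k::int. S (up i) = center / 2 + q * k" if "i \<le> n" for i
    using that
  proof (induction i rule: inc_induct)
    case base
    show ?case using S_left[of "up n"] by (intro exI[of _ 0]) simp
  next
    case (step i)
    then obtain k :: int where "S (up (Suc i)) = center / 2 + q * k" by blast
    moreover have "Suc i \<in> {1..n}" using step by simp
    ultimately have "S (up i) = center / 2 + q * of_int (k + int (N' (Suc i)))"
      using S_const[of "Suc i" "up i"] S_diff[of "Suc i"] N'[of "Suc i"] interlace[of "Suc i"]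
      by (simp add: algebra_simps)
    then show ?case by blast
  qed
  have T_up: "\<exists>k::int. T (up i) = center / 2 + p * k" if "i \<le> n" for i
    using that
  proof (induction i)
    case 0
    show ?case using T_right[of "up 0"] by (intro exI[of _ 0]) simp
  next
    case (Suc i)
    then obtain k :: int where "T (up i) = center / 2 + p * k" by auto
    moreover have "Suc i \<in> {1..n}" using Suc by simp
    ultimately have "T (up (Suc i)) = center / 2 + p * of_int (k - int (N (Suc i)))"
      using T_const[of "Suc i" "down (Suc i)"] T_diff[of "Suc i"] N[of "Suc i"] interlace[of "Suc i"]
      by (simp add: algebra_simps)
    then show ?case by blast
  qed
  \<comment> \<open>On each edge one coordinate is constant and equals its value at a minimum, so
    the graph runs along lattice lines.\<close>
  have graph: "(\<exists>k::int. S c = center / 2 + q * k) \<or> (\<exists>k::int. T c = center / 2 + p * k)" for c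
  proof (cases rule: piece_cases[of c])
    case 1
    then show ?thesis using S_left[of c] by (intro disjI1 exI[of _ 0]) simp
  next
    case 2
    then show ?thesis using T_right[of c] by (intro disjI2 exI[of _ 0]) simp
  next
    case (3 i)
    then show ?thesis using T_const[OF 3] T_up[of i] by simp
  next
    case (4 i)
    then have "S c = S (up (i - 1))"
      using S_const[OF 4] S_const[of i "up (i - 1)"] by simp
    then show ?thesis using S_up[of "i - 1"] 4(1) by auto
  qed
  define x where "x j = center / 2 + q * of_int j" for j :: int
  define z where "z k = center / 2 + p * of_int k" for k :: int
  have x_less: "x i < x j \<longleftrightarrow> i < j" and z_less: "z i < z j \<longleftrightarrow> i < j" for i j
    using assms(1,2) by (simp_all add: x_def z_def)
  have graph': "(\<exists>k. S c = x k) \<or> (\<exists>k. T c = z k)" for c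
    using graph by (simp add: x_def z_def)
  txt \<open>
    The first point may lie on the boundary of the cell: the segment to the second is in the open
    cell from any positive time on, and that is where it would have to leave the region.
  \<close>
  have uncut: "(s' + t', s' - t') \<in> region"
    if st: "(s + t, s - t) \<in> region" "x j \<le> s" "s \<le> x (j + 1)" "z k \<le> t" "t \<le> z (k + 1)"
      and st': "x j < s'" "s' < x (j + 1)" "z k < t'" "t' < z (k + 1)" for s t s' t' j k
  proof -
    have s: "x 0 < s" "t < z 0" "T (s + t) < t"
      using st(1) by (auto simp: region_iff_T x_def z_def)
    \<comment> \<open>The cell meets the quadrant, whose corner is a lattice point, so the open cell
      lies in the quadrant and only the graph can separate the two points.\<close>
    have "x 0 < x (j + 1)" "z k < z 0" using s st by linarith+
    then have "0 \<le> j" "k + 1 \<le> 0" by (simp_all add: x_less z_less)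
    then have "x 0 \<le> x j" "z (k + 1) \<le> z 0" by (simp_all add: x_less z_less flip: not_less)
    moreover have "T (s' + t') < t'"
    proof (rule ccontr)
      define s_at where "s_at u = (1 - u) * s + u * s'" for u
      define t_at where "t_at u = (1 - u) * t + u * t'" for u
      \<comment> \<open>A zero of \<open>h\<close> is a point where the segment meets the graph;
        then \<open>S\<close> and \<open>T\<close> both take values strictly between lattice levels,
        contradicting \<open>graph'\<close>.\<close>
      define h where "h u = t_at u - T (s_at u + t_at u)" for u
      assume "\<not> T (s' + t') < t'"
      then have "h 1 \<le> 0" "0 \<le> h 0" "0 < h 0"
        using s(3) by (simp_all add: h_def s_at_def t_at_def)
      moreover have "continuous_on {0..1} h"
      proof -
        have "continuous_on UNIV f"
          using pl unfolding piecewise_linear_with_slopes_def by blast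
        then have T: "continuous_on UNIV T"
          unfolding T_def by (intro continuous_intros) auto
        show ?thesis
          unfolding h_def s_at_def t_at_def
          by (intro continuous_intros continuous_on_compose2[OF T _ subset_UNIV])
      qed
      ultimately obtain u where u: "0 \<le> u" "u \<le> 1" "h u = 0"
        using IVT2'[of h 1 0 0] by auto
      with \<open>0 < h 0\<close> have "0 < u" by (cases "u = 0") auto
      have T: "T (s_at u + t_at u) = t_at u" using u(3) by (simp add: h_def)
      then have S: "S (s_at u + t_at u) = s_at u"
        using S_plus_T[of "s_at u + t_at u"] by simp
      have "x j < s_at u" "s_at u < x (j + 1)" "z k < t_at u" "t_at u < z (k + 1)"
        unfolding s_at_def t_at_def using st st' \<open>0 < u\<close> u(2)
        by (intro convex_combination_gt convex_combination_lt; simp)+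
      with graph'[of "s_at u + t_at u"] S T show False
        by (auto simp: x_less z_less)
    qed
    ultimately show ?thesis
      using st' by (auto simp: region_iff_T x_def z_def)
  qed
  \<comment> \<open>By \<open>uncut\<close>, any other point of the open cell would select the same
    cells as the midpoint.\<close>
  define K where "K = {(j, k). (x j + q / 2 + (z k + p / 2), x j + q / 2 - (z k + p / 2)) \<in> region}"
  have x_Suc: "x (j + 1) = x j + q" and z_Suc: "z (j + 1) = z j + p" for j
    by (simp_all add: x_def z_def algebra_simps)
  have "finite K"
  proof (rule finite_subset)
    show "K \<subseteq> {0..\<lceil>(S (up 0) - center / 2) / q\<rceil>} \<times> {\<lfloor>(T (up n) - center / 2) / p\<rfloor> - 1..0}"
    proof clarify
      fix j k assume "(j, k) \<in> K"
      define s where "s = x j + q / 2"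
      define t where "t = z k + p / 2"
      have in_region: "(s + t, s - t) \<in> region"
        using \<open>(j, k) \<in> K\<close> by (simp add: K_def s_def t_def)
      then have st: "center / 2 < s" "t < center / 2" "T (s + t) < t" "s < S (s + t)"
        by (simp add: region_iff_T, simp add: region_iff_T, simp add: region_iff_T,
            simp add: region_iff_S)
      \<comment> \<open>Left of \<open>up n\<close> and right of \<open>up 0\<close> the graph
        coincides with the sides of the quadrant and leaves no room for the region.\<close>
      have "\<not> s + t \<le> up n" using st S_left by force
      then have t_gt: "T (up n) < t" using T_mono[of "up n" "s + t"] st by simp
      have "\<not> up 0 \<le> s + t" using st T_right by force
      then have s_less: "s < S (up 0)" using S_mono[of "s + t" "up 0"] st by simp
      have "x 0 < x (j + 1)" "z k < z 0"
        using st(1,2) assms(1,2) unfolding x_Suc s_def t_def by (simp_all add: x_def z_def)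
      then have "0 \<le> j" "k \<le> 0" by (simp_all add: x_less z_less)
      have "q * of_int j \<le> S (up 0) - center / 2"
        using s_less \<open>q > 0\<close> by (simp add: s_def x_def)
      then have "of_int j \<le> (S (up 0) - center / 2) / q"
        using \<open>q > 0\<close> by (simp add: pos_le_divide_eq mult.commute)
      then have "j \<le> \<lceil>(S (up 0) - center / 2) / q\<rceil>" by linarith
      \<comment> \<open>The midpoint lies below the upper level \<open>z (k + 1)\<close>, whence the
        shift by 1 in the lower bound for \<open>k\<close>.\<close>
      have "T (up n) - center / 2 \<le> p * of_int (k + 1)"
        using t_gt \<open>p > 0\<close> by (simp add: t_def z_def algebra_simps)
      then have "(T (up n) - center / 2) / p \<le> of_int (k + 1)"
        using \<open>p > 0\<close> by (simp add: pos_divide_le_eq mult.commute)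
      then have "\<lfloor>(T (up n) - center / 2) / p\<rfloor> - 1 \<le> k" by linarith
      show "j \<in> {0..\<lceil>(S (up 0) - center / 2) / q\<rceil>} \<and>
          k \<in> {\<lfloor>(T (up n) - center / 2) / p\<rfloor> - 1..0}"
        by simp (use \<open>0 \<le> j\<close> \<open>k \<le> 0\<close> \<open>j \<le> _\<close> \<open>_ \<le> k\<close> in linarith)
    qed
  qed simp
  define corner where "corner = (\<lambda>(j, k). (x j + z k, x j - z k))"
  have opened: "(s + t, s - t) \<in> interior ((+) (corner (j, k)) ` aniso_rectangle (- q) p) \<longleftrightarrow>
      x j < s \<and> s < x (j + 1) \<and> z k < t \<and> t < z (k + 1)" for s t j k
    by (simp add: mem_interior_translate_aniso_rectangle corner_def x_Suc z_Suc)
  have closed: "(s + t, s - t) \<in> (+) (corner (j, k)) ` aniso_rectangle (- q) p \<longleftrightarrow>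
      x j \<le> s \<and> s \<le> x (j + 1) \<and> z k \<le> t \<and> t \<le> z (k + 1)" for s t j k
    by (simp add: mem_translate_aniso_rectangle corner_def x_Suc z_Suc)
  have rotate: "\<exists>s t. v = (s + t, s - t)" for v :: "real \<times> real"
    by (intro exI[of _ "(fst v + snd v) / 2"] exI[of _ "(fst v - snd v) / 2"])
       (simp add: prod_eq_iff field_simps)
  show ?thesis
    unfolding tiled_by_translates_def
  proof (intro exI[of _ "corner ` K"] conjI)
    show "finite (corner ` K)" using \<open>finite K\<close> by simp
    show "disjoint_family_on (\<lambda>v. interior ((+) v ` aniso_rectangle (- q) p)) (corner ` K)"
      unfolding disjoint_family_on_def
    proof (intro ballI impI equals0I)
      fix v v' w
      assume "v \<in> corner ` K" "v' \<in> corner ` K" "v \<noteq> v'"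
        and w: "w \<in> interior ((+) v ` aniso_rectangle (- q) p) \<inter>
          interior ((+) v' ` aniso_rectangle (- q) p)"
      then obtain j k j' k' where v: "v = corner (j, k)" "v' = corner (j', k')" by auto
      obtain s t where "w = (s + t, s - t)" using rotate by blast
      with w have "x j < s \<and> s < x (j + 1) \<and> z k < t \<and> t < z (k + 1)"
        "x j' < s \<and> s < x (j' + 1) \<and> z k' < t \<and> t < z (k' + 1)"
        by (simp_all add: v opened)
      then have "x j < x (j' + 1)" "x j' < x (j + 1)" "z k < z (k' + 1)" "z k' < z (k + 1)"
        by linarith+
      then have "j = j'" "k = k'" by (simp_all add: x_less z_less)
      with v \<open>v \<noteq> v'\<close> show False by simp
    qed
    show "(\<Union>v\<in>corner ` K. interior ((+) v ` aniso_rectangle (- q) p)) \<subseteq> region"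
    proof
      fix w assume "w \<in> (\<Union>v\<in>corner ` K. interior ((+) v ` aniso_rectangle (- q) p))"
      then obtain j k where jk: "(j, k) \<in> K"
        "w \<in> interior ((+) (corner (j, k)) ` aniso_rectangle (- q) p)" by auto
      obtain s t where w: "w = (s + t, s - t)" using rotate by blast
      show "w \<in> region"
        unfolding w
      proof (rule uncut)
        show "(x j + q / 2 + (z k + p / 2), x j + q / 2 - (z k + p / 2)) \<in> region"
          using jk(1) by (simp add: K_def)
      qed (use jk(2) assms(1,2) in \<open>auto simp: w opened x_Suc z_Suc\<close>)
    qed
    show "region \<subseteq> (\<Union>v\<in>corner ` K. (+) v ` aniso_rectangle (- q) p)"
    proof
      fix w assume "w \<in> region"
      obtain s t where w: "w = (s + t, s - t)" using rotate by blast
      \<comment> \<open>Rounding down gives a cell on whose edge \<open>w\<close> may lie;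
        \<open>uncut\<close> allows this and still puts the midpoint into the region.\<close>
      define j where "j = \<lfloor>(s - center / 2) / q\<rfloor>"
      define k where "k = \<lfloor>(t - center / 2) / p\<rfloor>"
      have "of_int j \<le> (s - center / 2) / q" "(s - center / 2) / q < of_int j + 1"
        "of_int k \<le> (t - center / 2) / p" "(t - center / 2) / p < of_int k + 1"
        unfolding j_def k_def by linarith+
      then have tile: "x j \<le> s" "s \<le> x (j + 1)" "z k \<le> t" "t \<le> z (k + 1)"
        using assms(1,2) by (simp_all add: x_def z_def field_simps)
      have "(j, k) \<in> K"
        unfolding K_def mem_Collect_eq prod.case
        by (rule uncut[OF \<open>w \<in> region\<close>[unfolded w] tile])
           (use assms(1,2) in \<open>simp_all add: x_Suc z_Suc\<close>)
      moreover have "w \<in> (+) (corner (j, k)) ` aniso_rectangle (- q) p"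
        unfolding w closed using tile by simp
      ultimately show "w \<in> (\<Union>v\<in>corner ` K. (+) v ` aniso_rectangle (- q) p)" by blast
    qed
  qed
qed

section \<open>From a tiling to integral side lengths\<close>

text \<open>Every line with t strictly between \<open>T (down i)\<close> and
  \<open>T (up (i - 1))\<close> leaves the region through the edge where S =
  \<open>S (down i)\<close>, so its slice is the interval from \<open>center / 2\<close> to that
  value.\<close>

lemma S_down_if_tiled:
  assumes tiled: "tiled_by_translates (aniso_rectangle (- q) p) region" and "q > 0" and i: "i \<in> {1..n}"
  obtains m :: nat where "S (down i) - center / 2 = q * real m"
proof (rule tiled_slice_first[OF tiled \<open>q > 0\<close> S_ge])
  show "T (down i) < T (up (i - 1))" using T_diff[OF i] interlace[OF i] by linarith
  fix s t assume t: "T (down i) < t" "t < T (up (i - 1))"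
  define c where "c = S (down i) + t"
  have up: "S (up (i - 1)) = S (down i)" using S_const[OF i, of "up (i - 1)"] interlace[OF i] by simp
  have "down i < c" "c < up (i - 1)"
    using t S_plus_T[of "down i"] S_plus_T[of "up (i - 1)"] up by (simp_all add: c_def)
  then have "T c = t" using S_const[OF i, of c] S_plus_T[of c] c_def by linarith
  \<comment> \<open>\<open>c\<close> is the parameter of the crossing point. Beyond it monotonicity
    of \<open>T\<close> applies; before it the point \<open>s + t\<close> is either left of the
    edge, where \<open>T\<close> is too small, or on the edge, where \<open>S\<close> is
    known.\<close>
  have "T (s + t) < t \<longleftrightarrow> s < S (down i)"
  proof
    have "c \<le> s + t \<longleftrightarrow> S (down i) \<le> s" by (simp add: c_def)
    moreover assume "T (s + t) < t"
    ultimately show "s < S (down i)" using T_mono[of c "s + t"] \<open>T c = t\<close> by (metis not_le)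
  next
    assume s: "s < S (down i)"
    show "T (s + t) < t"
    proof (cases "s + t \<le> down i")
      case True
      then show ?thesis using T_mono[OF True] t by simp
    next
      case False
      with s \<open>c < up (i - 1)\<close> have "S (s + t) = S (down i)"
        by (intro S_const[OF i]) (auto simp: c_def)
      then show ?thesis using S_plus_T[of "s + t"] s by simp
    qed
  qed
  moreover have "t < center / 2" using t T_le[of "up (i - 1)"] by simp
  ultimately show "(s + t, s - t) \<in> region \<longleftrightarrow> center / 2 < s \<and> s < S (down i)"
    by (auto simp: region_iff_T)
qed (rule that)

text \<open>The mirror image: lines of constant s enter the region through the edge where T =
  \<open>T (up i)\<close> and leave it at the side of the quadrant.\<close>

lemma T_up_if_tiled:
  assumes tiled: "tiled_by_translates (aniso_rectangle (- q) p) region" and "p > 0" and i: "i \<in> {1..n}"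
  obtains m :: nat where "center / 2 - T (up i) = p * real m"
proof (rule tiled_slice_second[OF tiled \<open>p > 0\<close> T_le])
  show "S (up i) < S (down i)" using S_diff[OF i] interlace[OF i] by linarith
  fix s t assume s: "S (up i) < s" "s < S (down i)"
  define c where "c = s + T (up i)"
  have down: "T (down i) = T (up i)" using T_const[OF i, of "down i"] interlace[OF i] by simp
  have "up i < c" "c < down i"
    using s S_plus_T[of "down i"] S_plus_T[of "up i"] down by (simp_all add: c_def)
  then have "S c = s" using T_const[OF i, of c] S_plus_T[of c] c_def by linarith
  have "s < S (s + t) \<longleftrightarrow> T (up i) < t"
  proof
    have "s + t \<le> c \<longleftrightarrow> t \<le> T (up i)" by (simp add: c_def)
    moreover assume "s < S (s + t)"
    ultimately show "T (up i) < t" using S_mono[of "s + t" c] \<open>S c = s\<close> by (metis not_le)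
  next
    assume t: "T (up i) < t"
    show "s < S (s + t)"
    proof (cases "down i \<le> s + t")
      case True
      then show ?thesis using S_mono[OF True] s by simp
    next
      case False
      with t \<open>up i < c\<close> have "T (s + t) = T (up i)"
        by (intro T_const[OF i]) (auto simp: c_def)
      then show ?thesis using S_plus_T[of "s + t"] t by simp
    qed
  qed
  moreover have "center / 2 < s" using s S_ge[of "up i"] by simp
  ultimately show "(s + t, s - t) \<in> region \<longleftrightarrow> T (up i) < t \<and> t < center / 2"
    by (auto simp: region_iff_S)
qed (rule that)

text \<open>Each gap is the difference of the coordinates of two corners, both of which are
  multiples by the slice lemmas.\<close>

lemma multiples_if_tiled:
  assumes tiled: "tiled_by_translates (aniso_rectangle (- q) p) region"
    and "p > 0" "q > 0" and i: "i \<in> {1..n}"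
  shows "\<exists>m>0. up (i - 1) - down i = p * real m" "\<exists>m>0. down i - up i = q * real m"
proof -
  have pos_nat: "\<exists>m>0. d = e * real m" if "d > 0" "e > 0" "d = e * real m1 - e * real m2" for d e m1 m2
  proof -
    have "e * real m2 < e * real m1" using that(1,3) by linarith
    then have "m2 < m1" using \<open>e > 0\<close> by simp
    then show ?thesis using that(3)
      by (intro exI[of _ "m1 - m2"]) (simp add: of_nat_diff right_diff_distrib)
  qed
  obtain m1 where m1: "center / 2 - T (up i) = p * real m1"
    using T_up_if_tiled[OF tiled \<open>p > 0\<close> i] by blast
  \<comment> \<open>The corner at \<open>up 0\<close> lies on the side of the quadrant, so its
    multiple is 0; the slice lemma covers the other indices.\<close>
  have "\<exists>m2::nat. center / 2 - T (up (i - 1)) = p * real m2"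
  proof (cases "i = 1")
    case True
    then show ?thesis using T_right[of "up 0"] by (intro exI[of _ 0]) simp
  next
    case False
    then show ?thesis using T_up_if_tiled[OF tiled \<open>p > 0\<close>, of "i - 1"] i by fastforce
  qed
  then obtain m2 :: nat where m2: "center / 2 - T (up (i - 1)) = p * real m2" by blast
  have "T (down i) = T (up i)" using T_const[OF i, of "down i"] interlace[OF i] by simp
  with m1 m2 T_diff[OF i] have "up (i - 1) - down i = p * real m1 - p * real m2" by simp
  with interlace[OF i] show "\<exists>m>0. up (i - 1) - down i = p * real m"
    by (intro pos_nat[OF _ \<open>p > 0\<close>, of _ m1 m2]) simp_all
  obtain k1 where k1: "S (down i) - center / 2 = q * real k1"
    using S_down_if_tiled[OF tiled \<open>q > 0\<close> i] by blast
  \<comment> \<open>Likewise \<open>up n\<close> has multiple 0; otherwise \<open>up i\<close>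
    shares its S with the maximum \<open>down (Suc i)\<close> on its left.\<close>
  have "\<exists>k2::nat. S (up i) - center / 2 = q * real k2"
  proof (cases "i = n")
    case True
    then show ?thesis using S_left[of "up n"] by (intro exI[of _ 0]) simp
  next
    case False
    then have "Suc i \<in> {1..n}" using i by simp
    then show ?thesis
      using S_down_if_tiled[OF tiled \<open>q > 0\<close>, of "Suc i"] S_const[of "Suc i" "up i"]
        interlace[of "Suc i"] by fastforce
  qed
  then obtain k2 :: nat where k2: "S (up i) - center / 2 = q * real k2" by blast
  with k1 S_diff[OF i] have "down i - up i = q * real k1 - q * real k2" by simp
  with interlace[OF i] show "\<exists>m>0. down i - up i = q * real m"
    by (intro pos_nat[OF _ \<open>q > 0\<close>, of _ k1 k2]) simp_all
qed

section \<open>The equivalence for arbitrary positive side lengths\<close>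

text \<open>Piecewise linearity and the lower bound hold for every such profile, so only the tiling
  is at stake; interlacing fixes the signs inside the absolute values.\<close>

lemma multiples_iff_aniso_partition_profile:
  assumes "p > 0" "q > 0"
  shows "(\<exists>N N' :: nat \<Rightarrow> nat. \<forall>i\<in>{1..n}. N i > 0 \<and> N' i > 0 \<and>
           \<bar>down i - up (i - 1)\<bar> = p * real (N i) \<and> \<bar>up i - down i\<bar> = q * real (N' i))
         \<longleftrightarrow> is_aniso_partition_profile (- q) p center f"
    (is "?multiples \<longleftrightarrow> ?profile")
proof -
  have abs: "\<bar>down i - up (i - 1)\<bar> = up (i - 1) - down i" "\<bar>up i - down i\<bar> = down i - up i"
    if "i \<in> {1..n}" for i
    using interlace[OF that] by auto
  have "?profile \<longleftrightarrow> tiled_by_translates (aniso_rectangle (- q) p) region"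
    using assms profile_ge piecewise_linear_slopes_mono[OF pl, of UNIV]
    by (simp add: is_aniso_partition_profile_def region_def)
  also have "\<dots> \<longleftrightarrow> ?multiples"
  proof
    assume "tiled_by_translates (aniso_rectangle (- q) p) region"
    note mult = multiples_if_tiled[OF this assms]
    have "\<forall>i\<in>{1..n}. \<exists>m>0. \<bar>down i - up (i - 1)\<bar> = p * real m"
      using mult(1) abs(1) by metis
    moreover have "\<forall>i\<in>{1..n}. \<exists>m>0. \<bar>up i - down i\<bar> = q * real m"
      using mult(2) abs(2) by metis
    ultimately
    show ?multiples by metis
  next
    assume ?multiples
    then obtain N N' :: "nat \<Rightarrow> nat" where "\<And>i. i \<in> {1..n} \<Longrightarrow>
        \<bar>down i - up (i - 1)\<bar> = p * real (N i) \<and> \<bar>up i - down i\<bar> = q * real (N' i)"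
      by blast
    then show "tiled_by_translates (aniso_rectangle (- q) p) region"
      using abs by (intro tiled_if_multiples[OF assms, of N N']) metis+
  qed
  finally show ?thesis by blast
qed

end

theorem proposition1p7:
  fixes eps hbar eps1 eps2 a :: real and n :: nat
    and up down :: "nat \<Rightarrow> real" and f :: "real \<Rightarrow> real"
  assumes "eps > 0" and "hbar > 0"
    and "\<forall>i\<in>{1..n}. up i < down i \<and> down i < up (i - 1)"
    and "a = (\<Sum>i=0..n. up i) - (\<Sum>i=1..n. down i)"
    and "is_dk_profile n up down f"
    and "eps1 = (eps + sqrt (eps\<^sup>2 + 4 * hbar)) / 2"
    and "eps2 = (eps - sqrt (eps\<^sup>2 + 4 * hbar)) / 2"
  shows
    "((\<exists>N N' :: nat \<Rightarrow> nat. \<forall>i\<in>{1..n}. N i > 0 \<and> N' i > 0 \<and>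
         \<bar>down i - up (i - 1)\<bar> = eps * real (N i) \<and>
         \<bar>up i - down i\<bar> = hbar / eps * real (N' i))
       \<longleftrightarrow> is_aniso_partition_profile (- hbar / eps) eps a f)
     \<and>
     ((\<exists>N N' :: nat \<Rightarrow> nat. \<forall>i\<in>{1..n}. N i > 0 \<and> N' i > 0 \<and>
         \<bar>down i - up (i - 1)\<bar> = eps1 * real (N i) \<and>
         \<bar>up i - down i\<bar> = hbar / eps1 * real (N' i))
       \<longleftrightarrow> is_aniso_partition_profile eps2 eps1 a f)"
proof -
  interpret dk_profile n up down f
    using assms(3,5) by unfold_locales auto
  have a: "a = center" using assms(4) by (simp add: dk_center_def)
  have "eps1 > 0" using assms(1,2) unfolding assms(6)
    by (intro divide_pos_pos add_pos_nonneg) auto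
  \<comment> \<open>The two numbers are the roots of X^2 - eps X - hbar, so
    \<open>hbar / eps1\<close> is exactly the side length \<open>- eps2\<close>.\<close>
  have "eps1 * eps2 = - hbar"
    using assms(2) unfolding assms(6,7) by (simp add: field_simps power2_eq_square[symmetric])
  then have "eps2 = - (hbar / eps1)" using \<open>eps1 > 0\<close> by (simp add: field_simps)
  then show ?thesis
    using multiples_iff_aniso_partition_profile[of eps "hbar / eps"]
      multiples_iff_aniso_partition_profile[of eps1 "hbar / eps1"] assms(1,2) \<open>eps1 > 0\<close>
    by (simp add: a)
qed

end
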